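(* Let $k\geq m\geq 2$ and $n\geq \ell\geq 2$ be integers. Then $BR(B_{k,m},B_{n,\ell})=k+n-1$.
   Context: For bipartite graphs $G_1,G_2$, $BR(G_1,G_2)$ is the least integer $N$ such that every red/blue edge-coloring of the complete bipartite graph $K_{N,N}$ contains a red copy of $G_1$ or a blue copy of $G_2$. $B_{k,m}$ denotes the bistar on $k+m$ vertices: a vertex $v$ of degree $k$, a vertex $w$ adjacent to $v$ of degree $m$, and $k+m-2$ further vertices of degree $1$. *)

theory Defs
  imports Main
begin

record 'a graph =
  verts :: "'a set"
  edges :: "'a set set"

definition simple_graph :: "'a graph \<Rightarrow> bool" where
  "simple_graph G \<longleftrightarrow> (\<forall>e\<in>edges G. e \<subseteq> verts G \<and> card e = 2)"

definition bipartite :: "'a graph \<Rightarrow> bool" where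
  "bipartite G \<longleftrightarrow> (\<exists>X Y. X \<union> Y = verts G \<and> X \<inter> Y = {} \<and>
     (\<forall>e\<in>edges G. \<exists>x\<in>X. \<exists>y\<in>Y. e = {x, y}))"

definition degree :: "'a graph \<Rightarrow> 'a \<Rightarrow> nat" where
  "degree G v = card {e \<in> edges G. v \<in> e}"

text \<open>\<open>H\<close> contains a copy of \<open>G\<close> as a (not necessarily induced) subgraph.\<close>

definition contains_copy :: "'b graph \<Rightarrow> 'a graph \<Rightarrow> bool" where
  "contains_copy H G \<longleftrightarrow>
     (\<exists>f. inj_on f (verts G) \<and> f ` verts G \<subseteq> verts H \<and> (\<forall>e\<in>edges G. f ` e \<in> edges H))"

definition complete_bipartite :: "nat \<Rightarrow> nat \<Rightarrow> (nat + nat) graph" where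
  "complete_bipartite a b =
     \<lparr> verts = Inl ` {..<a} \<union> Inr ` {..<b},
       edges = {{Inl i, Inr j} | i j. i < a \<and> j < b} \<rparr>"

datatype colour = Red | Blue

definition colour_class :: "'a graph \<Rightarrow> ('a set \<Rightarrow> colour) \<Rightarrow> colour \<Rightarrow> 'a graph" where
  "colour_class G c x = \<lparr> verts = verts G, edges = {e \<in> edges G. c e = x} \<rparr>"

text \<open>The infimum of a nonempty set of natural numbers is its least element, while the infimum
  of the empty set is 0. Hence a positive value of \<open>BR\<close> always means that a suitable \<open>N\<close> exists.
  Colourings are total functions on vertex sets; only their values on edges matter.\<close>

definition BR :: "'a graph \<Rightarrow> 'b graph \<Rightarrow> nat" where
  "BR G1 G2 = Inf {N. \<forall>c.
     contains_copy (colour_class (complete_bipartite N N) c Red) G1 \<or>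
     contains_copy (colour_class (complete_bipartite N N) c Blue) G2}"

text \<open>The two centres are \<open>Inl 0\<close> (degree \<open>k\<close>) and \<open>Inr 0\<close> (degree \<open>m\<close>). The leaves
  at \<open>Inl 0\<close> are \<open>Inr j\<close> with \<open>0 < j < k\<close>, those at \<open>Inr 0\<close> are \<open>Inl i\<close> with \<open>0 < i < m\<close>.\<close>

definition bistar :: "nat \<Rightarrow> nat \<Rightarrow> (nat + nat) graph" where
  "bistar k m =
     \<lparr> verts = Inl ` {..<m} \<union> Inr ` {..<k},
       edges = {{Inl 0, Inr j} | j. j < k} \<union> {{Inl i, Inr 0} | i. i < m} \<rparr>"

lemma card_verts_bistar: "card (verts (bistar k m)) = k + m"
proof -
  have "card (Inl ` {..<m} \<union> Inr ` {..<k} :: (nat + nat) set)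
      = card (Inl ` {..<m} :: (nat + nat) set) + card (Inr ` {..<k} :: (nat + nat) set)"
    by (rule card_Un_disjoint) auto
  then show ?thesis
    by (simp add: bistar_def card_image)
qed

lemma simple_graph_bistar:
  assumes "k \<ge> 1" "m \<ge> 1"
  shows "simple_graph (bistar k m)"
  using assms by (auto simp: simple_graph_def bistar_def)

lemma bipartite_bistar:
  assumes "k \<ge> 1" "m \<ge> 1"
  shows "bipartite (bistar k m)"
proof -
  have "\<exists>x\<in>Inl ` {..<m}. \<exists>y\<in>Inr ` {..<k}. e = {x, y}" if e: "e \<in> edges (bistar k m)" for e
  proof -
    obtain i j where "e = {Inl i, Inr j}" "i < m" "j < k"
    proof -
      from e consider j where "e = {Inl 0, Inr j}" "j < k" | i where "e = {Inl i, Inr 0}" "i < m"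
        unfolding bistar_def by auto
      then show thesis
      proof cases
        case (1 j)
        then show thesis using that[of 0 j] assms by simp
      next
        case (2 i)
        then show thesis using that[of i 0] assms by simp
      qed
    qed
    then show ?thesis by blast
  qed
  moreover have "Inl ` {..<m} \<union> Inr ` {..<k} = verts (bistar k m)"
    by (simp add: bistar_def)
  moreover have "Inl ` {..<m} \<inter> Inr ` {..<k} = ({} :: (nat + nat) set)"
    by auto
  ultimately show ?thesis
    unfolding bipartite_def by (intro exI conjI ballI)
qed

lemma centres_adjacent_bistar:
  assumes "k \<ge> 1"
  shows "{Inl 0, Inr 0} \<in> edges (bistar k m)"
  using assms by (auto simp: bistar_def)

lemma degree_bistar_left:
  assumes "k \<ge> 1" "m \<ge> 1"
  shows "degree (bistar k m) (Inl 0) = k"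
proof -
  have "{e \<in> edges (bistar k m). Inl 0 \<in> e} = (\<lambda>j. {Inl 0, Inr j}) ` {..<k}"
    using assms by (auto simp: bistar_def)
  moreover have "inj_on (\<lambda>j. {Inl 0, Inr j} :: (nat + nat) set) {..<k}"
    by (auto simp: inj_on_def doubleton_eq_iff)
  ultimately show ?thesis
    by (simp add: degree_def card_image)
qed

lemma degree_bistar_right:
  assumes "k \<ge> 1" "m \<ge> 1"
  shows "degree (bistar k m) (Inr 0) = m"
proof -
  have "{e \<in> edges (bistar k m). Inr 0 \<in> e} = (\<lambda>i. {Inl i, Inr 0}) ` {..<m}"
    using assms by (auto simp: bistar_def)
  moreover have "inj_on (\<lambda>i. {Inl i, Inr 0} :: (nat + nat) set) {..<m}"
    by (auto simp: inj_on_def doubleton_eq_iff)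
  ultimately show ?thesis
    by (simp add: degree_def card_image)
qed

lemma degree_bistar_leaf:
  assumes "x \<in> verts (bistar k m)" "x \<noteq> Inl 0" "x \<noteq> Inr 0"
  shows "degree (bistar k m) x = 1"
proof (cases x)
  case (Inl i)
  then have "{e \<in> edges (bistar k m). x \<in> e} = {{Inl i, Inr 0}}"
    using assms by (auto simp: bistar_def)
  then show ?thesis by (simp add: degree_def)
next
  case (Inr j)
  then have "{e \<in> edges (bistar k m). x \<in> e} = {{Inl 0, Inr j}}"
    using assms by (auto simp: bistar_def)
  then show ?thesis by (simp add: degree_def)
qed

end

theory Submission
  imports Defs
begin

text \<open>Upper bound: for \<open>N = k + n - 1\<close> every vertex has red degree at least \<open>k\<close> or blue degree at
  least \<open>n\<close>. If there is no bistar of either kind, the red neighbours of the set \<open>A\<close> of left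
  vertices of red degree at least \<open>k\<close> lie in the set \<open>B\<close> of right vertices of blue degree at
  least \<open>n\<close>, and have red degree less than \<open>m\<close>. Counting red edges from \<open>A\<close> gives
  \<open>|A| < |B|\<close>, and counting blue edges from \<open>B\<close> gives \<open>|B| < |A|\<close>, unless both are empty. By
  symmetry no vertex has red degree at least \<open>k\<close>, and then any blue edge yields a blue bistar.

  Lower bound: the circulant colouring of \<open>K\<^bsub>M,M\<^esub>\<close> with \<open>M = (k - 1) + (n - 1)\<close> has all red
  degrees equal to \<open>k - 1\<close> and all blue degrees equal to \<open>n - 1\<close>.\<close>

section \<open>Copies of bistars and vertex degrees\<close>

lemma ex_inj_on_pointed:
  assumes "y \<in> S" "k \<le> card S" "k \<ge> 1"
  shows "\<exists>f. inj_on f {..<k} \<and> f ` {..<k} \<subseteq> S \<and> f (0::nat) = y"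
proof -
  have fin: "finite S" using assms by (metis card.infinite not_one_le_zero le_trans)
  have "card {1..<k} \<le> card (S - {y})" using assms fin by simp
  then obtain f where f: "f ` {1..<k} \<subseteq> S - {y}" "inj_on f {1..<k}"
    using card_le_inj[of "{1..<k}" "S - {y}"] fin by auto
  have k: "{..<k} = insert 0 {1..<k}" using assms by auto
  show ?thesis
  proof (intro exI conjI)
    show "inj_on (f(0 := y)) {..<k}"
      unfolding k using f by (auto simp: inj_on_def)
    show "(f(0 := y)) ` {..<k} \<subseteq> S" unfolding k using f assms by auto
  qed simp
qed

text \<open>\<open>S\<close> and \<open>T\<close> consist of neighbours of \<open>v\<close> and
  \<open>w\<close>, each containing the opposite centre, so \<open>k\<close> and \<open>m\<close>
  count that centre along with the leaves. Index 0 goes to a centre on both sides, and disjointness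
  makes the combined map injective.\<close>

lemma contains_copy_bistarI:
  assumes "S \<subseteq> verts H" "T \<subseteq> verts H" "S \<inter> T = {}" "w \<in> S" "v \<in> T"
    and "k \<le> card S" "m \<le> card T" "k \<ge> 1" "m \<ge> 1"
    and S: "\<And>s. s \<in> S \<Longrightarrow> {v, s} \<in> edges H" and T: "\<And>t. t \<in> T \<Longrightarrow> {t, w} \<in> edges H"
  shows "contains_copy H (bistar k m)"
proof -
  obtain f where f: "inj_on f {..<k}" "f ` {..<k} \<subseteq> S" "f 0 = w"
    using ex_inj_on_pointed[of w S k] assms by blast
  obtain g where g: "inj_on g {..<m}" "g ` {..<m} \<subseteq> T" "g 0 = v"
    using ex_inj_on_pointed[of v T m] assms by blast
  have fS: "f j \<in> S" if "j < k" for j using f(2) that by auto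
  have gT: "g i \<in> T" if "i < m" for i using g(2) that by auto
  have disj: "f j \<noteq> g i" if "j < k" "i < m" for i j
    using fS[OF that(1)] gT[OF that(2)] \<open>S \<inter> T = {}\<close> by (metis disjoint_iff)
  have "inj_on (case_sum g f) (verts (bistar k m))"
    using f(1) g(1) disj disj[symmetric] by (auto simp: bistar_def inj_on_def)
  moreover have "case_sum g f ` verts (bistar k m) \<subseteq> verts H"
    using subsetD[OF assms(1) fS] subsetD[OF assms(2) gT] by (auto simp: bistar_def)
  moreover have "\<forall>e\<in>edges (bistar k m). case_sum g f ` e \<in> edges H"
    using S[OF fS] T[OF gT] f(3) g(3) by (auto simp: bistar_def)
  ultimately show ?thesis unfolding contains_copy_def by blast
qed

text \<open>The obstruction behind the lower bound: injectivity keeps the \<open>k\<close> edges at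
  the centre \<open>Inl 0\<close> distinct in \<open>H\<close>.\<close>

lemma contains_copy_bistar_imp_degree:
  assumes "contains_copy H (bistar k m)" "m \<ge> 1" "finite (edges H)"
  shows "\<exists>v\<in>verts H. k \<le> degree H v"
proof -
  obtain f where f: "inj_on f (verts (bistar k m))" "f ` verts (bistar k m) \<subseteq> verts H"
    "\<forall>e\<in>edges (bistar k m). f ` e \<in> edges H"
    using assms unfolding contains_copy_def by blast
  have dom: "Inl 0 \<in> verts (bistar k m)" "\<And>j. j < k \<Longrightarrow> Inr j \<in> verts (bistar k m)"
    using assms by (auto simp: bistar_def)
  have inj: "inj_on (\<lambda>j. {f (Inl 0), f (Inr j)}) {..<k}"
    using f(1) dom by (auto simp: inj_on_def doubleton_eq_iff)
  have "{f (Inl 0), f (Inr j)} \<in> edges H" if "j < k" for j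
    using f(3)[rule_format, of "{Inl 0, Inr j}"] that by (auto simp: bistar_def)
  then have "(\<lambda>j. {f (Inl 0), f (Inr j)}) ` {..<k} \<subseteq> {e \<in> edges H. f (Inl 0) \<in> e}"
    by auto
  then have "card ((\<lambda>j. {f (Inl 0), f (Inr j)}) ` {..<k}) \<le> degree H (f (Inl 0))"
    unfolding degree_def using assms by (intro card_mono) auto
  then have "k \<le> degree H (f (Inl 0))" using inj by (simp add: card_image)
  then show ?thesis using f(2) dom by blast
qed

section \<open>Double counting between the two sides\<close>

text \<open>Counting the pairs related by \<open>P\<close> from both sides gives
  \<open>k * card A \<le> d * card B\<close>.\<close>

lemma card_less_by_degrees:
  assumes "finite A" "finite B" "A \<noteq> {}" "d < k"
    and "\<And>x. x \<in> A \<Longrightarrow> k \<le> card {y \<in> B. P x y}"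
    and "\<And>y. y \<in> B \<Longrightarrow> card {x \<in> A. P x y} \<le> d"
  shows "card A < card B"
proof -
  have "k * card A \<le> (\<Sum>x\<in>A. card {y \<in> B. P x y})"
    using sum_mono[of A "\<lambda>_. k" "\<lambda>x. card {y \<in> B. P x y}"] assms by (simp add: mult.commute)
  also have "\<dots> = (\<Sum>y\<in>B. card {x \<in> A. P x y})"
    using sum_multicount_gen[of A B P "\<lambda>y. card {x \<in> A. P x y}"] assms by simp
  also have "\<dots> \<le> d * card B"
    using sum_mono[of B "\<lambda>y. card {x \<in> A. P x y}" "\<lambda>_. d"] assms by (simp add: mult.commute)
  finally have le: "k * card A \<le> d * card B" .
  have "card A > 0" using assms by (simp add: card_gt_0_iff)
  then have "d * card A < k * card A" using assms by simp
  with le show ?thesis by (metis mult_less_cancel1 order_less_le_trans)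
qed

text \<open>\<open>P\<close> is the red adjacency relation; its negation is the blue one.\<close>

lemma red_degree_less:
  assumes "finite X" "finite Y" and kn: "1 \<le> m" "m \<le> k" "1 \<le> l" "l \<le> n"
    and X: "\<And>x. x \<in> X \<Longrightarrow> k \<le> card {y \<in> Y. P x y} \<or> n \<le> card {y \<in> Y. \<not> P x y}"
    and Y: "\<And>y. y \<in> Y \<Longrightarrow> k \<le> card {x \<in> X. P x y} \<or> n \<le> card {x \<in> X. \<not> P x y}"
    and red: "\<And>x y. x \<in> X \<Longrightarrow> y \<in> Y \<Longrightarrow> P x y \<Longrightarrow> k \<le> card {y \<in> Y. P x y} \<Longrightarrow> card {x \<in> X. P x y} < m"
    and blue: "\<And>x y. x \<in> X \<Longrightarrow> y \<in> Y \<Longrightarrow> \<not> P x y \<Longrightarrow> n \<le> card {x \<in> X. \<not> P x y} \<Longrightarrow>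
      card {y \<in> Y. \<not> P x y} < l"
    and x: "x \<in> X"
  shows "card {y \<in> Y. P x y} < k"
proof (rule ccontr)
  assume neg: "\<not> card {y \<in> Y. P x y} < k"
  define A where "A = {x \<in> X. k \<le> card {y \<in> Y. P x y}}"
  define B where "B = {y \<in> Y. n \<le> card {x \<in> X. \<not> P x y}}"
  have fin: "finite A" "finite B" using assms by (auto simp: A_def B_def)
  have "A \<noteq> {}" using neg x by (auto simp: A_def)
  \<comment> \<open>By \<open>red\<close>, a red neighbour of \<open>a\<close> has red degree below
    \<open>m \<le> k\<close>, so its blue degree is at least \<open>n\<close>.\<close>
  have redB: "{y \<in> B. P a y} = {y \<in> Y. P a y}" if "a \<in> A" for a
    using that Y red kn by (fastforce simp: A_def B_def)
  \<comment> \<open>Dually, a blue neighbour of \<open>y\<close> has blue degree below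
    \<open>l \<le> n\<close>, hence red degree at least \<open>k\<close>.\<close>
  have blueA: "{a \<in> A. \<not> P a y} = {x \<in> X. \<not> P x y}" if "y \<in> B" for y
    using that X blue kn by (fastforce simp: A_def B_def)
  have "card A < card B"
  proof (rule card_less_by_degrees[of _ _ "m - 1" k P])
    show "k \<le> card {y \<in> B. P a y}" if "a \<in> A" for a
      using that redB by (simp add: A_def)
    show "card {x \<in> A. P x y} \<le> m - 1" if "y \<in> B" for y
    \<comment> \<open>The bound \<open>red\<close> applies only through a red edge from
      \<open>A\<close> to \<open>y\<close>; without one the count is 0.\<close>
    proof (cases "{x \<in> A. P x y} = {}")
      case False
      then obtain a where "a \<in> A" "P a y" by blast
      then have "card {x \<in> X. P x y} < m" using red that by (auto simp: A_def B_def)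
      moreover have "card {x \<in> A. P x y} \<le> card {x \<in> X. P x y}"
        using \<open>finite X\<close> by (intro card_mono) (auto simp: A_def)
      ultimately show ?thesis by simp
    qed (metis card.empty le0)
  qed (use fin \<open>A \<noteq> {}\<close> kn in auto)
  moreover have "card B < card A"
  proof (rule card_less_by_degrees[of _ _ "l - 1" n "\<lambda>y x. \<not> P x y"])
    \<comment> \<open>The first count supplies the nonemptiness that the second one needs.\<close>
    show "B \<noteq> {}" using \<open>card A < card B\<close> by auto
    show "n \<le> card {a \<in> A. \<not> P a y}" if "y \<in> B" for y
      using that blueA by (simp add: B_def)
    show "card {y \<in> B. \<not> P a y} \<le> l - 1" if "a \<in> A" for a
    proof (cases "{y \<in> B. \<not> P a y} = {}")
      case False
      then obtain y where "y \<in> B" "\<not> P a y" by blast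
      then have "card {y \<in> Y. \<not> P a y} < l" using blue that by (auto simp: A_def B_def)
      moreover have "card {y \<in> B. \<not> P a y} \<le> card {y \<in> Y. \<not> P a y}"
        using \<open>finite Y\<close> by (intro card_mono) (auto simp: B_def)
      ultimately show ?thesis by simp
    qed (metis card.empty le0)
  qed (use fin kn in auto)
  ultimately show False by simp
qed

section \<open>Red and blue subgraphs of the complete bipartite graph\<close>

abbreviation colour_graph :: "nat \<Rightarrow> ((nat + nat) set \<Rightarrow> colour) \<Rightarrow> colour \<Rightarrow> (nat + nat) graph" where
  "colour_graph N c x \<equiv> colour_class (complete_bipartite N N) c x"

lemma edge_colour_graph:
  "{Inl i, Inr j} \<in> edges (colour_graph N c x) \<longleftrightarrow> i < N \<and> j < N \<and> c {Inl i, Inr j} = x"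
  by (auto simp: colour_class_def complete_bipartite_def doubleton_eq_iff)

lemma verts_colour_graph: "verts (colour_graph N c x) = Inl ` {..<N} \<union> Inr ` {..<N}"
  by (simp add: colour_class_def complete_bipartite_def)

text \<open>A bistar can lie on the edge in two ways, with its centre of degree \<open>p\<close> on
  the left or on the right; \<open>deg\<close> covers both.\<close>

lemma contains_copy_colour_graph:
  assumes "i < N" "j < N" "c {Inl i, Inr j} = x" "p \<ge> 1" "q \<ge> 1"
    and deg: "p \<le> card {j \<in> {..<N}. c {Inl i, Inr j} = x} \<and> q \<le> card {i \<in> {..<N}. c {Inl i, Inr j} = x}
      \<or> q \<le> card {j \<in> {..<N}. c {Inl i, Inr j} = x} \<and> p \<le> card {i \<in> {..<N}. c {Inl i, Inr j} = x}"
  shows "contains_copy (colour_graph N c x) (bistar p q)"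
proof -
  define S :: "(nat + nat) set" where "S = Inr ` {j \<in> {..<N}. c {Inl i, Inr j} = x}"
  define T :: "(nat + nat) set" where "T = Inl ` {i \<in> {..<N}. c {Inl i, Inr j} = x}"
  have card: "card S = card {j \<in> {..<N}. c {Inl i, Inr j} = x}"
    "card T = card {i \<in> {..<N}. c {Inl i, Inr j} = x}"
    unfolding S_def T_def by (simp_all add: card_image)
  have V: "S \<subseteq> verts (colour_graph N c x)" "T \<subseteq> verts (colour_graph N c x)"
    by (auto simp: S_def T_def verts_colour_graph)
  have D: "S \<inter> T = {}" "T \<inter> S = {}" by (auto simp: S_def T_def)
  have M: "Inr j \<in> S" "Inl i \<in> T" using assms by (auto simp: S_def T_def)
  have E: "{Inl i, s} \<in> edges (colour_graph N c x)" "{s, Inl i} \<in> edges (colour_graph N c x)"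
    if "s \<in> S" for s
    using that assms by (auto simp: S_def edge_colour_graph insert_commute)
  have F: "{t, Inr j} \<in> edges (colour_graph N c x)" "{Inr j, t} \<in> edges (colour_graph N c x)"
    if "t \<in> T" for t
    using that assms by (auto simp: T_def edge_colour_graph insert_commute)
  from deg show ?thesis
  proof
    assume "p \<le> card {j \<in> {..<N}. c {Inl i, Inr j} = x} \<and> q \<le> card {i \<in> {..<N}. c {Inl i, Inr j} = x}"
    then show ?thesis
      using contains_copy_bistarI[OF V D(1) M _ _ \<open>p \<ge> 1\<close> \<open>q \<ge> 1\<close> E(1) F(1)] card by simp
  next
    assume "q \<le> card {j \<in> {..<N}. c {Inl i, Inr j} = x} \<and> p \<le> card {i \<in> {..<N}. c {Inl i, Inr j} = x}"
    then show ?thesis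
      using contains_copy_bistarI[OF V(2,1) D(2) M(2,1) _ _ \<open>p \<ge> 1\<close> \<open>q \<ge> 1\<close> F(2) E(2)] card by simp
  qed
qed

section \<open>The upper bound\<close>

lemma bistar_upper_bound:
  fixes k m n l :: nat
  assumes kn: "1 \<le> m" "m \<le> k" "1 \<le> l" "l \<le> n"
  defines "N \<equiv> k + n - 1"
  shows "contains_copy (colour_graph N c Red) (bistar k m) \<or>
    contains_copy (colour_graph N c Blue) (bistar n l)"
proof (rule ccontr)
  assume no: "\<not> ?thesis"
  define P where "P i j \<longleftrightarrow> c {Inl i, Inr j} = Red" for i j
  have P: "c {Inl i, Inr j} = Red \<longleftrightarrow> P i j" "c {Inl i, Inr j} = Blue \<longleftrightarrow> \<not> P i j" for i j
    by (cases "c {Inl i, Inr j}"; simp add: P_def)+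
  \<comment> \<open>Pigeonhole: red degree at most \<open>k - 1\<close> and blue degree at most
    \<open>n - 1\<close> would sum to less than \<open>N\<close>.\<close>
  have split: "k \<le> card {j \<in> {..<N}. Q j} \<or> n \<le> card {j \<in> {..<N}. \<not> Q j}" for Q
  proof -
    have "{..<N} = {j \<in> {..<N}. Q j} \<union> {j \<in> {..<N}. \<not> Q j}" by auto
    then have "N \<le> card {j \<in> {..<N}. Q j} + card {j \<in> {..<N}. \<not> Q j}"
      by (metis card_Un_le card_lessThan)
    then show ?thesis using kn unfolding N_def by linarith
  qed
  have kn1: "1 \<le> k" "1 \<le> n" using kn by auto
  \<comment> \<open>The two statements exclude the two orientations of a red bistar on the
    edge.\<close>
  have red: "k \<le> card {j \<in> {..<N}. P i j} \<Longrightarrow> card {i \<in> {..<N}. P i j} < m"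
    "k \<le> card {i \<in> {..<N}. P i j} \<Longrightarrow> card {j \<in> {..<N}. P i j} < m"
    if "i < N" "j < N" "P i j" for i j
    using contains_copy_colour_graph[of i N j c Red k m] that no kn(1,3) kn1
    unfolding P not_le[symmetric] by blast+
  have blue: "n \<le> card {j \<in> {..<N}. \<not> P i j} \<Longrightarrow> card {i \<in> {..<N}. \<not> P i j} < l"
    "n \<le> card {i \<in> {..<N}. \<not> P i j} \<Longrightarrow> card {j \<in> {..<N}. \<not> P i j} < l"
    if "i < N" "j < N" "\<not> P i j" for i j
    using contains_copy_colour_graph[of i N j c Blue n l] that no kn(1,3) kn1
    unfolding P not_le[symmetric] by blast+
  have 1: "card {j \<in> {..<N}. P i j} < k" if "i < N" for i
    by (rule red_degree_less[of "{..<N}" "{..<N}" m k l n P])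
      (use kn split red(1) blue(2) that in \<open>simp_all add: not_le\<close>)
  \<comment> \<open>The sides are exchanged by transposing \<open>P\<close>, which calls for the
    other halves of \<open>red\<close> and \<open>blue\<close>.\<close>
  have 2: "card {i \<in> {..<N}. P i j} < k" if "j < N" for j
    by (rule red_degree_less[of "{..<N}" "{..<N}" m k l n "\<lambda>j i. P i j"])
      (use kn split red(2) blue(1) that in \<open>simp_all add: not_le\<close>)
  have "0 < N" using kn by (simp add: N_def)
  \<comment> \<open>Red degrees below \<open>k\<close> force blue degrees of at least
    \<open>n\<close> by \<open>split\<close>, so both ends of a blue edge at vertex 0 have blue
    degree at least \<open>n \<ge> l\<close>.\<close>
  then have d: "n \<le> card {j \<in> {..<N}. \<not> P 0 j}" using 1[of 0] split[of "P 0"] by linarith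
  then have "{j \<in> {..<N}. \<not> P 0 j} \<noteq> {}" using kn by (metis card.empty le_trans not_one_le_zero)
  then obtain j where j: "j < N" "\<not> P 0 j" by blast
  then have "n \<le> card {i \<in> {..<N}. \<not> P i j}" using 2[of j] split[of "\<lambda>i. P i j"] by linarith
  then show False using blue(1)[of 0 j] d j kn \<open>0 < N\<close> by simp
qed

section \<open>The lower bound by a circulant colouring\<close>

text \<open>As \<open>N \<le> M\<close>, the residues of \<open>i + j\<close> modulo
  \<open>M\<close> are distinct for distinct \<open>j < N\<close>.\<close>

lemma card_cyclic_window_le:
  assumes "N \<le> M" "finite A"
  shows "card {j \<in> {..<N}. ((i::nat) + j) mod M \<in> A} \<le> card A"
proof (rule card_inj_on_le[OF _ _ assms(2)])
  show "inj_on (\<lambda>j. (i + j) mod M) {j \<in> {..<N}. (i + j) mod M \<in> A}"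
  proof (rule inj_onI)
    fix a b assume *: "a \<in> {j \<in> {..<N}. (i + j) mod M \<in> A}" "b \<in> {j \<in> {..<N}. (i + j) mod M \<in> A}"
      "(i + a) mod M = (i + b) mod M"
    then have "a mod M = b mod M" by (simp add: nat_mod_eq_iff add.assoc)
    then show "a = b" using * assms by simp
  qed
qed auto

lemma degree_colour_graph:
  "degree (colour_graph N c x) (Inl i) \<le> card {j \<in> {..<N}. c {Inl i, Inr j} = x}"
  "degree (colour_graph N c x) (Inr j) \<le> card {i \<in> {..<N}. c {Inl i, Inr j} = x}"
proof -
  have "{e \<in> edges (colour_graph N c x). Inl i \<in> e}
      \<subseteq> (\<lambda>j. {Inl i, Inr j}) ` {j \<in> {..<N}. c {Inl i, Inr j} = x}"
    by (auto simp: colour_class_def complete_bipartite_def)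
  then show "degree (colour_graph N c x) (Inl i) \<le> card {j \<in> {..<N}. c {Inl i, Inr j} = x}"
    unfolding degree_def by (rule surj_card_le[rotated]) simp
  have "{e \<in> edges (colour_graph N c x). Inr j \<in> e}
      \<subseteq> (\<lambda>i. {Inl i, Inr j}) ` {i \<in> {..<N}. c {Inl i, Inr j} = x}"
    by (auto simp: colour_class_def complete_bipartite_def)
  then show "degree (colour_graph N c x) (Inr j) \<le> card {i \<in> {..<N}. c {Inl i, Inr j} = x}"
    unfolding degree_def by (rule surj_card_le[rotated]) simp
qed

lemma finite_edges_colour_graph: "finite (edges (colour_graph N c x))"
proof (rule finite_subset)
  show "edges (colour_graph N c x) \<subseteq> Pow (Inl ` {..<N} \<union> Inr ` {..<N})"
    by (auto simp: colour_class_def complete_bipartite_def)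
qed simp

text \<open>All \<open>N\<close> up to the circulant size are treated at once, by restricting one
  colouring, so minimality in \<open>BR\<close> requires no monotonicity argument.\<close>

lemma bistar_lower_bound:
  fixes k m n l :: nat
  assumes kn: "1 \<le> m" "1 \<le> k" "1 \<le> l" "1 \<le> n" and N: "N \<le> (k - 1) + (n - 1)"
  shows "\<exists>c. \<not> contains_copy (colour_graph N c Red) (bistar k m) \<and>
    \<not> contains_copy (colour_graph N c Blue) (bistar n l)"
proof -
  define M where "M = (k - 1) + (n - 1)"
  define c :: "(nat + nat) set \<Rightarrow> colour" where
    "c e = (if \<exists>i j. e = {Inl i, Inr j} \<and> (i + j) mod M < k - 1 then Red else Blue)" for e
  \<comment> \<open>The residues that receive colour \<open>x\<close>: \<open>k - 1\<close> red ones
    and \<open>n - 1\<close> blue ones.\<close>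
  define A where "A x = (case x of Red \<Rightarrow> {..<k - 1} | Blue \<Rightarrow> {k - 1..<M})" for x
  have A: "finite (A x)" for x by (simp add: A_def split: colour.split)
  have c: "c {Inl i, Inr j} = x \<longleftrightarrow> (i + j) mod M \<in> A x" if "i < N" "j < N" for i j x
  proof -
    \<comment> \<open>Positivity of \<open>M\<close> keeps residues below \<open>M\<close>, so those
      that are not red fall in \<open>{k - 1..<M}\<close>.\<close>
    have "0 < M" using that N unfolding M_def by linarith
    then have "(i + j) mod M < M" by simp
    then show ?thesis
      by (cases x) (auto simp: c_def A_def doubleton_eq_iff)
  qed
  have "degree (colour_graph N c x) v \<le> card (A x)" if "v \<in> verts (colour_graph N c x)" for v x
  proof (cases v)
    case (Inl i)
    have "{j \<in> {..<N}. c {Inl i, Inr j} = x} = {j \<in> {..<N}. (i + j) mod M \<in> A x}"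
      using c that Inl by (auto simp: verts_colour_graph)
    then show ?thesis
      using degree_colour_graph(1)[of N c x i] card_cyclic_window_le[of N M "A x" i] A N Inl
      by (simp add: M_def)
  next
    case (Inr j)
    have "{i \<in> {..<N}. c {Inl i, Inr j} = x} = {i \<in> {..<N}. (j + i) mod M \<in> A x}"
      using c that Inr by (auto simp: verts_colour_graph add.commute)
    then show ?thesis
      using degree_colour_graph(2)[of N c x j] card_cyclic_window_le[of N M "A x" j] A N Inr
      by (simp add: M_def)
  qed
  then have no_copy: "\<not> contains_copy (colour_graph N c x) (bistar p q)"
    if "card (A x) < p" "q \<ge> 1" for x p q
    using that contains_copy_bistar_imp_degree[OF _ _ finite_edges_colour_graph]
    by (meson le_trans not_le)
  have "card (A Red) < k" "card (A Blue) < n"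
    using kn by (auto simp: A_def M_def)
  then show ?thesis
    using no_copy[of Red k m] no_copy[of Blue n l] kn by (intro exI[of _ c] conjI)
qed

theorem theorem12:
  fixes k m n l :: nat
  assumes "k \<ge> m" and "m \<ge> 2" and "n \<ge> l" and "l \<ge> 2"
  shows "BR (bistar k m) (bistar n l) = k + n - 1"
  unfolding BR_def
proof (rule cInf_eq_minimum)
  show "k + n - 1 \<in> {N. \<forall>c. contains_copy (colour_graph N c Red) (bistar k m) \<or>
      contains_copy (colour_graph N c Blue) (bistar n l)}"
    using bistar_upper_bound[of m k l n] assms by simp
next
  fix N assume N: "N \<in> {N. \<forall>c. contains_copy (colour_graph N c Red) (bistar k m) \<or>
      contains_copy (colour_graph N c Blue) (bistar n l)}"
  show "k + n - 1 \<le> N"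
  proof (rule ccontr)
    assume "\<not> k + n - 1 \<le> N"
    \<comment> \<open>Since \<open>k\<close> and \<open>n\<close> are positive, neither subtraction
      truncates and the sum is \<open>k + n - 2\<close>.\<close>
    then have "N \<le> (k - 1) + (n - 1)" using assms by simp
    moreover have "1 \<le> m" "1 \<le> k" "1 \<le> l" "1 \<le> n" using assms by auto
    ultimately obtain c where "\<not> contains_copy (colour_graph N c Red) (bistar k m)"
      "\<not> contains_copy (colour_graph N c Blue) (bistar n l)"
      using bistar_lower_bound[of m k l n N] by blast
    then show False using N by blast
  qed
qed

end
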